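(* Let $k$ and $d$ be positive integers. If $D$ is a digraph with $\frac{1}{2}\mathrm{mad}(D) \leq k + \frac{d-k}{d+1}$ and $\Delta^{-}(D) \leq k+1$, then $D$ decomposes into $k+1$ pseudo-branchings $C_{1}, \ldots, C_{k}, C_{k+1}$ with $\Delta^{+}(C_{k+1}) \leq d$.
   Context: Digraphs are finite, may have multiple arcs, and have no loops. For a digraph $D$, $V(D)$ is its vertex set and $A(D)$ its arc set. For $v \in V(D)$, $d_D^-(v)$ is the number of arcs of $D$ with head $v$ and $d_D^+(v)$ is the number of arcs of $D$ with tail $v$; $\Delta^-(D) = \max_{v \in V(D)} d_D^-(v)$ and $\Delta^+(D) = \max_{v \in V(D)} d_D^+(v)$. The maximum average degree of a graph $G$ is $\mathrm{mad}(G) = \max_{H \subseteq G} \frac{2|E(H)|}{|V(H)|}$, the maximum being over subgraphs $H$ of $G$ with at least one vertex; for a digraph $D$, $\mathrm{mad}(D)$ is the maximum average degree of its underlying undirected multigraph, in which each arc contributes one edge (so $\frac12 \mathrm{mad}(D) = \max_{H \subseteq D} \frac{|A(H)|}{|V(H)|}$). A pseudo-branching in $D$ is a spanning subdigraph $C$ of $D$ (i.e. $V(C) = V(D)$) with $\Delta^-(C) \leq 1$; it may have no arcs. A decomposition of $D$ into subdigraphs is a family of pairwise arc-disjoint subdigraphs whose union is $D$. *)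

theory Defs
  imports Complex_Main "HOL-Library.Disjoint_Sets" "Graph_Theory.Digraph_Component"
begin

text \<open>
  Digraphs are the \<open>pre_digraph\<close> records of the Graph_Theory library: arcs are abstract
  objects with a tail and a head, so parallel arcs are allowed.  Subdigraphs, spanning
  subdigraphs and degrees are those of the library.
\<close>

section \<open>Maximum average degree\<close>

record ('v, 'e) multigraph =
  mverts :: "'v set"
  medges :: "'e set"
  mends :: "'e \<Rightarrow> 'v set"

definition wf_multigraph :: "('v, 'e) multigraph \<Rightarrow> bool" where
  "wf_multigraph G \<longleftrightarrow> (\<forall>e \<in> medges G. mends G e \<subseteq> mverts G)"

text \<open>
  As for the library's \<open>subgraph\<close>, the incidence functions have to agree everywhere, so a
  finite multigraph has only finitely many subgraphs.
\<close>

definition msubgraph :: "('v, 'e) multigraph \<Rightarrow> ('v, 'e) multigraph \<Rightarrow> bool" where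
  "msubgraph H G \<longleftrightarrow> mverts H \<subseteq> mverts G \<and> medges H \<subseteq> medges G \<and>
     wf_multigraph G \<and> wf_multigraph H \<and> mends H = mends G"

text \<open>Only meaningful for finite multigraphs with at least one vertex.\<close>

definition mad :: "('v, 'e) multigraph \<Rightarrow> real" where
  "mad G = Max {2 * real (card (medges H)) / real (card (mverts H)) | H.
     msubgraph H G \<and> mverts H \<noteq> {}}"

definition underlying_multigraph :: "('v, 'a) pre_digraph \<Rightarrow> ('v, 'a) multigraph" where
  "underlying_multigraph D =
     \<lparr> mverts = verts D, medges = arcs D, mends = (\<lambda>a. {tail D a, head D a}) \<rparr>"

definition digraph_mad :: "('v, 'a) pre_digraph \<Rightarrow> real" where
  "digraph_mad D = mad (underlying_multigraph D)"

section \<open>Maximum degrees\<close>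

text \<open>
  On \<open>nat\<close>, the supremum of a finite nonempty set is its maximum, and the supremum of the
  empty set is 0; the latter fixes the value for the digraph without vertices.
\<close>

definition max_in_degree :: "('v, 'a) pre_digraph \<Rightarrow> nat" where
  "max_in_degree D = (SUP v \<in> verts D. in_degree D v)"

definition max_out_degree :: "('v, 'a) pre_digraph \<Rightarrow> nat" where
  "max_out_degree D = (SUP v \<in> verts D. out_degree D v)"

section \<open>Pseudo-branchings and decompositions\<close>

definition pseudo_branching :: "('v, 'a) pre_digraph \<Rightarrow> ('v, 'a) pre_digraph \<Rightarrow> bool" where
  "pseudo_branching C D \<longleftrightarrow> spanning C D \<and> max_in_degree C \<le> 1"

definition decomposition ::
  "('v, 'a) pre_digraph \<Rightarrow> 'i set \<Rightarrow> ('i \<Rightarrow> ('v, 'a) pre_digraph) \<Rightarrow> bool" where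
  "decomposition D I C \<longleftrightarrow>
     (\<forall>i \<in> I. subgraph (C i) D) \<and>
     disjoint_family_on (\<lambda>i. arcs (C i)) I \<and>
     pre_digraph.Union D (C ` I) = D"

section \<open>Sanity checks\<close>

lemma max_in_degree_eq_Max:
  "verts D \<noteq> {} \<Longrightarrow> max_in_degree D = Max (in_degree D ` verts D)"
  by (simp add: max_in_degree_def Sup_nat_def)

lemma max_out_degree_eq_Max:
  "verts D \<noteq> {} \<Longrightarrow> max_out_degree D = Max (out_degree D ` verts D)"
  by (simp add: max_out_degree_def Sup_nat_def)

lemma msubgraph_underlying_iff:
  assumes "wf_digraph D"
  shows "msubgraph H (underlying_multigraph D) \<longleftrightarrow>
    (\<exists>H'. subgraph H' D \<and> H = underlying_multigraph H')"
proof
  assume H: "msubgraph H (underlying_multigraph D)"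
  let ?H' = "\<lparr>verts = mverts H, arcs = medges H, tail = tail D, head = head D\<rparr>"
  have "subgraph ?H' D"
    using H assms
    by (auto simp: subgraph_def msubgraph_def underlying_multigraph_def wf_multigraph_def
        compatible_def wf_digraph_def)
  moreover have "H = underlying_multigraph ?H'"
    using H by (simp add: msubgraph_def underlying_multigraph_def)
  ultimately show "\<exists>H'. subgraph H' D \<and> H = underlying_multigraph H'" by blast
next
  assume "\<exists>H'. subgraph H' D \<and> H = underlying_multigraph H'"
  then show "msubgraph H (underlying_multigraph D)"
    by (auto simp: subgraph_def msubgraph_def underlying_multigraph_def wf_multigraph_def
        compatible_def wf_digraph_def)
qed

lemma finite_subgraphs:
  assumes "fin_digraph D"
  shows "finite {H. subgraph H D}"
proof (rule finite_subset)
  let ?f = "\<lambda>(V, A). \<lparr>verts = V, arcs = A, tail = tail D, head = head D\<rparr>"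
  show "{H. subgraph H D} \<subseteq> ?f ` (Pow (verts D) \<times> Pow (arcs D))"
  proof
    fix H assume "H \<in> {H. subgraph H D}"
    then have "H = ?f (verts H, arcs H)" "verts H \<subseteq> verts D" "arcs H \<subseteq> arcs D"
      by (auto simp: subgraph_def compatible_def)
    then show "H \<in> ?f ` (Pow (verts D) \<times> Pow (arcs D))" by blast
  qed
  show "finite (?f ` (Pow (verts D) \<times> Pow (arcs D)))"
    using assms by (simp add: fin_digraph_def fin_digraph_axioms_def)
qed

lemma half_digraph_mad:
  assumes "fin_digraph D" and "verts D \<noteq> {}"
  shows "digraph_mad D / 2 =
    Max {real (card (arcs H)) / real (card (verts H)) | H. subgraph H D \<and> verts H \<noteq> {}}"
    (is "_ = Max ?S")
proof -
  have wf: "wf_digraph D" using assms(1) by (simp add: fin_digraph_def)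
  have fin: "finite ?S"
    by (rule finite_subset[OF _ finite_imageI[OF finite_subgraphs[OF assms(1)],
          of "\<lambda>H. real (card (arcs H)) / real (card (verts H))"]]) auto
  have "subgraph D D" using wf by (simp add: subgraph_def compatible_def)
  then have ne: "?S \<noteq> {}" using assms(2) by blast
  have "{2 * real (card (medges H)) / real (card (mverts H)) | H.
     msubgraph H (underlying_multigraph D) \<and> mverts H \<noteq> {}} = (\<lambda>x. 2 * x) ` ?S"
    (is "?L = ?R")
  proof (intro set_eqI iffI)
    fix x assume "x \<in> ?L"
    then obtain H' where H': "msubgraph H' (underlying_multigraph D)" "mverts H' \<noteq> {}"
      "x = 2 * real (card (medges H')) / real (card (mverts H'))" by blast
    then obtain H where H: "subgraph H D" "H' = underlying_multigraph H"
      unfolding msubgraph_underlying_iff[OF wf] by blast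
    have "verts H \<noteq> {}" "x = 2 * (real (card (arcs H)) / real (card (verts H)))"
      using H'(2,3) H(2) by (simp_all add: underlying_multigraph_def)
    with H(1) show "x \<in> ?R" by blast
  next
    fix x assume "x \<in> ?R"
    then obtain H where H: "subgraph H D" "verts H \<noteq> {}"
      "x = 2 * (real (card (arcs H)) / real (card (verts H)))" by blast
    have "msubgraph (underlying_multigraph H) (underlying_multigraph D)"
      using H(1) msubgraph_underlying_iff[OF wf] by blast
    moreover have "mverts (underlying_multigraph H) \<noteq> {}"
      "x = 2 * real (card (medges (underlying_multigraph H))) /
         real (card (mverts (underlying_multigraph H)))"
      using H(2,3) by (simp_all add: underlying_multigraph_def)
    ultimately show "x \<in> ?L" by blast
  qed
  then have "digraph_mad D = Max ((\<lambda>x. 2 * x) ` ?S)"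
    by (simp add: digraph_mad_def mad_def)
  also have "\<dots> = 2 * Max ?S"
    by (rule mono_Max_commute[symmetric, OF _ fin ne]) (simp add: mono_def)
  finally show ?thesis by simp
qed

end

theory Submission
  imports Defs
begin

text \<open>
  Every vertex has to distribute its incoming arcs injectively over the colours
  \<open>1, \<dots>, k + 1\<close>, so a decomposition amounts to choosing, for every vertex of in-degree
  \<open>k + 1\<close>, one incoming arc such that no vertex is the tail of more than \<open>d\<close> chosen arcs.
  By Hall's theorem this can only fail if some set \<open>S\<close> of such vertices has a set \<open>T\<close>
  of in-neighbours with \<open>d |T| < |S|\<close>.  But then \<open>S \<union> T\<close> spans at least \<open>(k + 1) |S|\<close>
  arcs on fewer than \<open>(1 + 1/d) |S|\<close> vertices, which is a density larger than
  \<open>d (k + 1) / (d + 1) = k + (d - k) / (d + 1)\<close>.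
\<close>

section \<open>Hall's theorem, plain and with capacities\<close>

text \<open>Induction on the size of \<open>I\<close>. If every nonempty proper subfamily has slack,
  any single choice can be fixed and its value removed from the other sets. Otherwise a tight proper
  subfamily \<open>J\<close> is matched on its own, and the rest is matched outside the union of
  \<open>J\<close>, so the two matchings cannot collide.\<close>

theorem hall_marriage:
  assumes "finite I" and "\<And>i. i \<in> I \<Longrightarrow> finite (A i)"
    and "\<And>J. J \<subseteq> I \<Longrightarrow> card J \<le> card (\<Union>i\<in>J. A i)"
  shows "\<exists>f. inj_on f I \<and> (\<forall>i\<in>I. f i \<in> A i)"
  using assms
proof (induction "card I" arbitrary: I A rule: less_induct)
  case less
  have finU: "finite (\<Union>i\<in>J. A i)" if "J \<subseteq> I" for J
    using that less.prems(1,2) by (meson finite_UN_I finite_subset subsetD)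
  consider (empty) "I = {}"
    | (slack) "I \<noteq> {}" "\<And>J. J \<subset> I \<Longrightarrow> J \<noteq> {} \<Longrightarrow> card J < card (\<Union>i\<in>J. A i)"
    | (tight) J where "J \<subset> I" "J \<noteq> {}" "card J = card (\<Union>i\<in>J. A i)"
    using less.prems(3) by (metis le_neq_implies_less psubset_imp_subset)
  then show ?case
  proof cases
    case empty
    then show ?thesis by simp
  next
    case slack
    then obtain i\<^sub>0 where i\<^sub>0: "i\<^sub>0 \<in> I" by blast
    have "card {i\<^sub>0} \<le> card (A i\<^sub>0)" using less.prems(3)[of "{i\<^sub>0}"] i\<^sub>0 by simp
    then obtain x where x: "x \<in> A i\<^sub>0" by fastforce
    have "\<exists>f. inj_on f (I - {i\<^sub>0}) \<and> (\<forall>i\<in>I - {i\<^sub>0}. f i \<in> A i - {x})"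
    proof (rule less.hyps)
      show "card (I - {i\<^sub>0}) < card I" using i\<^sub>0 less.prems(1) by (meson card_Diff1_less)
      fix J assume J: "J \<subseteq> I - {i\<^sub>0}"
      show "card J \<le> card (\<Union>i\<in>J. A i - {x})"
      proof (cases "J = {}")
        case False
        \<comment> \<open>Deleting \<open>x\<close> shrinks the union by at most one, which the
          strict inequality absorbs.\<close>
        have "card J < card (\<Union>i\<in>J. A i)" using slack(2)[of J] J i\<^sub>0 False by blast
        moreover have "card (\<Union>i\<in>J. A i) - 1 \<le> card ((\<Union>i\<in>J. A i) - {x})"
          by (simp add: card_Diff_singleton_if)
        ultimately have "card J \<le> card ((\<Union>i\<in>J. A i) - {x})" by linarith
        also have "(\<Union>i\<in>J. A i) - {x} = (\<Union>i\<in>J. A i - {x})" by blast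
        finally show ?thesis .
      qed simp
    qed (use less.prems(1,2) in auto)
    then obtain f where f: "inj_on f (I - {i\<^sub>0})" "\<And>i. i \<in> I - {i\<^sub>0} \<Longrightarrow> f i \<in> A i - {x}"
      by blast
    have "inj_on (f(i\<^sub>0 := x)) I"
      using f by (fastforce simp: inj_on_def)
    moreover have "\<forall>i\<in>I. (f(i\<^sub>0 := x)) i \<in> A i" using f(2) x by auto
    ultimately show ?thesis by blast
  next
    case tight
    let ?U = "\<Union>i\<in>J. A i"
    have finI: "finite J" using tight(1) less.prems(1) by (meson finite_subset psubset_imp_subset)
    have "\<exists>f. inj_on f J \<and> (\<forall>i\<in>J. f i \<in> A i)"
    proof (rule less.hyps)
      show "card J < card I" using tight(1) less.prems(1) by (simp add: psubset_card_mono)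
    qed (use tight(1) less.prems finI in auto)
    then obtain f where f: "inj_on f J" "\<And>i. i \<in> J \<Longrightarrow> f i \<in> A i" by blast
    have "\<exists>g. inj_on g (I - J) \<and> (\<forall>i\<in>I - J. g i \<in> A i - ?U)"
    proof (rule less.hyps)
      show "card (I - J) < card I"
        using tight(1,2) less.prems(1) by (intro psubset_card_mono) auto
      fix K assume K: "K \<subseteq> I - J"
      \<comment> \<open>Hall's condition for \<open>K\<close> outside \<open>?U\<close> is the
        condition for \<open>K \<union> J\<close> minus the equality for the tight family
        \<open>J\<close>.\<close>
      have "card K + card J = card (K \<union> J)"
        using K finI less.prems(1)
        by (intro card_Un_disjoint[symmetric]) (auto intro: finite_subset)
      also have "\<dots> \<le> card (\<Union>i\<in>K \<union> J. A i)"
        using less.prems(3)[of "K \<union> J"] K tight(1) by blast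
      also have "(\<Union>i\<in>K \<union> J. A i) = (\<Union>i\<in>K. A i - ?U) \<union> ?U" by blast
      also have "card \<dots> \<le> card (\<Union>i\<in>K. A i - ?U) + card ?U" by (rule card_Un_le)
      finally show "card K \<le> card (\<Union>i\<in>K. A i - ?U)" using tight(3) by linarith
    qed (use less.prems(1,2) in auto)
    then obtain g where g: "inj_on g (I - J)" "\<And>i. i \<in> I - J \<Longrightarrow> g i \<in> A i - ?U" by blast
    let ?h = "\<lambda>i. if i \<in> J then f i else g i"
    have "f i \<noteq> g j" if "i \<in> J" "j \<in> I - J" for i j
      using f(2)[of i] g(2)[of j] that by force
    then have "inj_on ?h (J \<union> (I - J))"
      by (intro inj_on_disjoint_Un f(1) g(1)) blast
    moreover have "J \<union> (I - J) = I" using tight(1) by blast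
    ultimately have "inj_on ?h I" by simp
    moreover have "\<forall>i\<in>I. ?h i \<in> A i" using f(2) g(2) by auto
    ultimately show ?thesis by blast
  qed
qed

text \<open>Each element is replaced by \<open>d\<close> copies, indexed by \<open>{..<d}\<close>.
  An injective choice of copies can hit the copies of a fixed \<open>x\<close> at most
  \<open>d\<close> times, because there the copy index determines \<open>i\<close>.\<close>

corollary hall_capacity:
  assumes "finite I" and "\<And>i. i \<in> I \<Longrightarrow> finite (A i)"
    and "\<And>J. J \<subseteq> I \<Longrightarrow> card J \<le> d * card (\<Union>i\<in>J. A i)"
  shows "\<exists>f. (\<forall>i\<in>I. f i \<in> A i) \<and> (\<forall>x. card {i \<in> I. f i = x} \<le> d)"
proof -
  have "\<exists>f. inj_on f I \<and> (\<forall>i\<in>I. f i \<in> A i \<times> {..<d})"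
  proof (rule hall_marriage)
    fix J assume "J \<subseteq> I"
    moreover have "(\<Union>i\<in>J. A i \<times> {..<d}) = (\<Union>i\<in>J. A i) \<times> {..<d}" by blast
    ultimately show "card J \<le> card (\<Union>i\<in>J. A i \<times> {..<d})"
      using assms(3)[of J] by (simp add: card_cartesian_product mult.commute)
  qed (use assms in auto)
  then obtain f where f: "inj_on f I" "\<And>i. i \<in> I \<Longrightarrow> f i \<in> A i \<times> {..<d}" by blast
  have "card {i \<in> I. fst (f i) = x} \<le> d" for x
  proof -
    have "inj_on (\<lambda>i. snd (f i)) {i \<in> I. fst (f i) = x}"
      using f(1) by (auto simp: inj_on_def prod_eq_iff)
    moreover have "(\<lambda>i. snd (f i)) ` {i \<in> I. fst (f i) = x} \<subseteq> {..<d}"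
      using f(2) by (auto simp: mem_Times_iff)
    ultimately have "card {i \<in> I. fst (f i) = x} \<le> card {..<d}"
      by (intro card_inj_on_le) auto
    then show ?thesis by simp
  qed
  moreover have "\<forall>i\<in>I. fst (f i) \<in> A i" using f(2) by (auto simp: mem_Times_iff)
  ultimately show ?thesis by (intro exI[of _ "\<lambda>i. fst (f i)"]) blast
qed

section \<open>Density bound and Hall's condition\<close>

lemma card_arcs_le_mad:
  assumes "fin_digraph D" and "subgraph H D" and "verts H \<noteq> {}"
  shows "real (card (arcs H)) \<le> digraph_mad D / 2 * real (card (verts H))"
proof -
  let ?S = "{real (card (arcs H)) / real (card (verts H)) | H. subgraph H D \<and> verts H \<noteq> {}}"
  have sub: "verts H \<subseteq> verts D" using assms(2) by (simp add: subgraph_def)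
  have "finite ?S"
    by (rule finite_subset[OF _ finite_imageI[OF finite_subgraphs[OF assms(1)],
          of "\<lambda>H. real (card (arcs H)) / real (card (verts H))"]]) auto
  then have "real (card (arcs H)) / real (card (verts H)) \<le> Max ?S"
    using assms(2,3) by (intro Max_ge) blast+
  also have "\<dots> = digraph_mad D / 2"
    using half_digraph_mad[OF assms(1)] sub assms(3) by (metis subset_empty)
  finally have "real (card (arcs H)) / real (card (verts H)) \<le> digraph_mad D / 2" .
  moreover have "finite (verts H)"
    using fin_digraph.finite_verts[OF assms(1)] sub finite_subset by blast
  then have "real (card (verts H)) > 0" using assms(3) by (simp add: card_gt_0_iff)
  ultimately show ?thesis by (simp add: divide_le_eq)
qed

text \<open>Hall's condition for the vertices of in-degree \<open>k + 1\<close>.\<close>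

lemma card_le_in_neighbours:
  fixes D :: "('v, 'a) pre_digraph" and k d :: nat
  assumes fin: "fin_digraph D"
    and mad: "digraph_mad D / 2 \<le> real k + (real d - real k) / (real d + 1)"
    and S: "S \<subseteq> verts D" "\<And>v. v \<in> S \<Longrightarrow> in_degree D v = k + 1"
  shows "card S \<le> d * card (tail D ` (\<Union>v\<in>S. in_arcs D v))"
proof (cases "S = {}")
  case False
  interpret fin_digraph D by (rule fin)
  define B where "B = (\<Union>v\<in>S. in_arcs D v)"
  define T where "T = tail D ` B"
  define H where "H = \<lparr>verts = S \<union> T, arcs = B, tail = tail D, head = head D\<rparr>"
  have finS: "finite S" using S(1) finite_verts finite_subset by blast
  have "subgraph H D"
    using S(1) wf_digraph_axioms
    by (auto simp: subgraph_def compatible_def wf_digraph_def H_def B_def T_def)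
  then have "real (card B) \<le> digraph_mad D / 2 * real (card (S \<union> T))"
    using card_arcs_le_mad[OF fin, of H] False by (simp add: H_def)
  \<comment> \<open>Over a common denominator the bound is \<open>d (k + 1) / (d + 1)\<close>. This
    form is visibly nonnegative, so the vertex count can be enlarged next: \<open>S\<close> and
    \<open>T\<close> may overlap, and only \<open>card S + card T\<close> is available as an upper
    bound.\<close>
  also have "\<dots> \<le> (real d * (real k + 1) / (real d + 1)) * real (card (S \<union> T))"
    using mad by (intro mult_right_mono) (auto simp: field_simps)
  also have "\<dots> \<le> (real d * (real k + 1) / (real d + 1)) * real (card S + card T)"
    by (intro mult_left_mono of_nat_mono card_Un_le) auto
  finally have "real (card B) * (real d + 1) \<le> real d * (real k + 1) * real (card S + card T)"
    by (simp add: field_simps)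
  \<comment> \<open>An arc has only one head, so the sets of incoming arcs are disjoint, with
    \<open>k + 1\<close> arcs each.\<close>
  moreover have "card B = (\<Sum>v\<in>S. card (in_arcs D v))"
    unfolding B_def using finS by (intro card_UN_disjoint) auto
  then have "card B = card S * (k + 1)" using S(2) by (simp add: in_degree_def)
  then have "real (card B) = (real k + 1) * real (card S)"
    by (simp add: algebra_simps)
  \<comment> \<open>The positive factor \<open>k + 1\<close> is exposed for cancellation; afterwards
    \<open>d * card S\<close> cancels on both sides.\<close>
  ultimately have "(real k + 1) * (real (card S) * (real d + 1))
      \<le> (real k + 1) * (real d * real (card S + card T))"
    by (simp only: mult_ac)
  then have "real (card S) * (real d + 1) \<le> real d * real (card S + card T)"
    by (rule mult_left_le_imp_le) simp
  then have "real (card S) \<le> real (d * card T)" by (simp add: algebra_simps)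
  then show ?thesis by (simp only: of_nat_le_iff T_def B_def)
qed simp

section \<open>Colouring the arcs into one vertex\<close>

text \<open>Meant for the set \<open>X\<close> of arcs into one vertex. The last colour is the one
  with an out-degree constraint, so it is used only when all \<open>k + 1\<close> colours are
  forced, and then on the prescribed arc \<open>x\<close>; otherwise the first \<open>k\<close>
  colours suffice.\<close>

lemma exists_injective_colouring:
  assumes "finite X" and "card X \<le> k + 1" and "card X = k + 1 \<Longrightarrow> x \<in> X"
  shows "\<exists>c. inj_on c X \<and> c ` X \<subseteq> {1..k + 1} \<and>
    (\<forall>y\<in>X. c y = k + 1 \<longrightarrow> card X = k + 1 \<and> y = x)"
proof (cases "card X = k + 1")
  case True
  with assms have "card (X - {x}) = card {1..k}" by simp
  then obtain c where c: "bij_betw c (X - {x}) {1..k}"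
    using assms(1) finite_same_card_bij by blast
  then have im: "c y \<in> {1..k}" if "y \<in> X" "y \<noteq> x" for y
    using that bij_betw_apply[OF c, of y] by simp
  have "inj_on (c(x := k + 1)) X"
  proof (rule inj_onI)
    fix y z assume "y \<in> X" "z \<in> X" "(c(x := k + 1)) y = (c(x := k + 1)) z"
    then show "y = z"
      using im[of y] im[of z] inj_onD[OF bij_betw_imp_inj_on[OF c], of y z]
      by (auto split: if_splits)
  qed
  moreover have "(c(x := k + 1)) ` X \<subseteq> {1..k + 1}"
  proof (rule image_subsetI)
    fix y assume "y \<in> X"
    then show "(c(x := k + 1)) y \<in> {1..k + 1}" using im[of y] by auto
  qed
  moreover have "\<forall>y\<in>X. (c(x := k + 1)) y = k + 1 \<longrightarrow> card X = k + 1 \<and> y = x"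
  proof (intro ballI impI conjI)
    fix y assume "y \<in> X" "(c(x := k + 1)) y = k + 1"
    then show "y = x" using im[of y] by (auto split: if_splits)
  qed (rule True)
  ultimately show ?thesis by blast
next
  case False
  with assms(2) have "card X \<le> card {1..k}" by simp
  then obtain c where c: "inj_on c X" "c ` X \<subseteq> {1..k}"
    using card_le_inj[OF assms(1), of "{1..k}"] by auto
  have "c y \<in> {1..k}" if "y \<in> X" for y using c(2) that by blast
  then have "c y \<in> {1..k + 1}" "c y \<noteq> k + 1" if "y \<in> X" for y
    using that by fastforce+
  with c(1) show ?thesis by blast
qed

section \<open>Assembling the decomposition\<close>

theorem theorem1p11:
  fixes D :: "('v, 'a) pre_digraph" and k d :: nat
  assumes "fin_digraph D" and "loopfree_digraph D"
    and "k > 0" and "d > 0"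
    and "digraph_mad D / 2 \<le> real k + (real d - real k) / (real d + 1)"
    and "max_in_degree D \<le> k + 1"
  shows "\<exists>C :: nat \<Rightarrow> ('v, 'a) pre_digraph.
    decomposition D {1..k + 1} C \<and>
    (\<forall>i \<in> {1..k + 1}. pseudo_branching (C i) D) \<and>
    max_out_degree (C (k + 1)) \<le> d"
proof -
  interpret fin_digraph D by (rule assms(1))
  have deg: "card (in_arcs D v) \<le> k + 1" if "v \<in> verts D" for v
  proof -
    have "in_degree D v \<le> max_in_degree D"
      unfolding max_in_degree_def using that by (intro cSUP_upper) auto
    then show ?thesis using assms(6) by (simp add: in_degree_def)
  qed
  define I where "I = {v \<in> verts D. in_degree D v = k + 1}"
  have "\<exists>t. (\<forall>v\<in>I. t v \<in> tail D ` in_arcs D v) \<and> (\<forall>u. card {v \<in> I. t v = u} \<le> d)"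
  proof (rule hall_capacity)
    fix J assume "J \<subseteq> I"
    then show "card J \<le> d * card (\<Union>v\<in>J. tail D ` in_arcs D v)"
      using card_le_in_neighbours[OF assms(1,5), of J] by (auto simp: I_def image_UN)
  qed (auto simp: I_def)
  then obtain t where t: "\<And>v. v \<in> I \<Longrightarrow> t v \<in> tail D ` in_arcs D v"
      "\<And>u. card {v \<in> I. t v = u} \<le> d"
    by blast
  \<comment> \<open>Hall's theorem selects only a tail \<open>t v\<close>; among possibly parallel
    arcs from \<open>t v\<close> to \<open>v\<close>, one arc \<open>p v\<close> is fixed.\<close>
  then have "\<forall>v. \<exists>a. v \<in> I \<longrightarrow> a \<in> in_arcs D v \<and> tail D a = t v" by fastforce
  then obtain p where p: "\<And>v. v \<in> I \<Longrightarrow> p v \<in> in_arcs D v \<and> tail D (p v) = t v" by metis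
  have "\<forall>v. \<exists>c. v \<in> verts D \<longrightarrow> inj_on c (in_arcs D v) \<and> c ` in_arcs D v \<subseteq> {1..k + 1} \<and>
      (\<forall>a\<in>in_arcs D v. c a = k + 1 \<longrightarrow> card (in_arcs D v) = k + 1 \<and> a = p v)"
  proof
    fix v
    show "\<exists>c. v \<in> verts D \<longrightarrow> inj_on c (in_arcs D v) \<and> c ` in_arcs D v \<subseteq> {1..k + 1} \<and>
        (\<forall>a\<in>in_arcs D v. c a = k + 1 \<longrightarrow> card (in_arcs D v) = k + 1 \<and> a = p v)"
    proof (cases "v \<in> verts D")
      case True
      then have "p v \<in> in_arcs D v" if "card (in_arcs D v) = k + 1"
        using that p[of v] by (simp add: I_def in_degree_def)
      then show ?thesis
        using exists_injective_colouring[of "in_arcs D v" k "p v"] deg[OF True] by blast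
    qed simp
  qed
  from choice[OF this] obtain c where c\<^sub>0: "\<forall>v. v \<in> verts D \<longrightarrow>
      inj_on (c v) (in_arcs D v) \<and> c v ` in_arcs D v \<subseteq> {1..k + 1} \<and>
      (\<forall>a\<in>in_arcs D v. c v a = k + 1 \<longrightarrow> card (in_arcs D v) = k + 1 \<and> a = p v)" ..
  have c: "inj_on (c v) (in_arcs D v)" "c v ` in_arcs D v \<subseteq> {1..k + 1}"
      "\<And>a. a \<in> in_arcs D v \<Longrightarrow> c v a = k + 1 \<Longrightarrow> v \<in> I \<and> a = p v"
    if "v \<in> verts D" for v
    using c\<^sub>0[rule_format, OF that] that unfolding I_def in_degree_def by blast+
  \<comment> \<open>An arc takes its colour from the colouring at its head, so injectivity there
    leaves at most one arc of each colour entering a vertex.\<close>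
  define C where "C i = \<lparr>verts = verts D, arcs = {a \<in> arcs D. c (head D a) a = i},
    tail = tail D, head = head D\<rparr>" for i
  have sub: "subgraph (C i) D" for i
    using wf_digraph_axioms by (auto simp: subgraph_def compatible_def wf_digraph_def C_def)
  have "c (head D a) a \<in> {1..k + 1}" if "a \<in> arcs D" for a
    using c(2)[of "head D a"] that by (auto simp: image_subset_iff)
  \<comment> \<open>The index set is nonempty, so the union recovers all vertices, isolated ones
    included.\<close>
  then have "pre_digraph.Union D (C ` {1..k + 1}) = D"
    by (intro pre_digraph.equality) (auto simp: pre_digraph.Union_def C_def)
  then have "decomposition D {1..k + 1} C"
    using sub by (auto simp: decomposition_def disjoint_family_on_def C_def)
  moreover have "pseudo_branching (C i) D" for i
  proof -
    have "in_degree (C i) v \<le> 1" if "v \<in> verts D" for v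
      unfolding in_degree_def using c(1)[OF that]
      by (subst One_nat_def, subst card_le_Suc0_iff_eq) (auto simp: C_def in_arcs_def inj_on_def)
    \<comment> \<open>Without vertices the supremum is 0; otherwise it is bounded pointwise.\<close>
    then have "max_in_degree (C i) \<le> 1"
      unfolding max_in_degree_def
      by (cases "verts D = {}") (auto simp: C_def intro!: cSUP_least)
    then show ?thesis using sub by (simp add: pseudo_branching_def spanning_def C_def)
  qed
  moreover have "max_out_degree (C (k + 1)) \<le> d"
  proof -
    have "out_degree (C (k + 1)) u \<le> d" for u
    proof -
      \<comment> \<open>Arcs of the last colour are chosen arcs \<open>p v\<close>, so those leaving
        \<open>u\<close> are counted by the vertices \<open>v\<close> with \<open>t v = u\<close>,
        at most \<open>d\<close> of them.\<close>
      have "out_arcs (C (k + 1)) u \<subseteq> p ` {v \<in> I. t v = u}"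
      proof
        fix a assume "a \<in> out_arcs (C (k + 1)) u"
        then have a: "a \<in> arcs D" "c (head D a) a = k + 1" "tail D a = u"
          by (auto simp: C_def)
        then have "head D a \<in> I" "a = p (head D a)"
          using c(3)[of "head D a" a] by auto
        then show "a \<in> p ` {v \<in> I. t v = u}" using p a(3) by fastforce
      qed
      moreover have "finite {v \<in> I. t v = u}" by (simp add: I_def)
      ultimately show ?thesis
        unfolding out_degree_def using t(2)[of u] by (meson le_trans surj_card_le)
    qed
    then show ?thesis
      unfolding max_out_degree_def
      by (cases "verts D = {}") (auto simp: C_def intro!: cSUP_least)
  qed
  ultimately show ?thesis by blast
qed

end
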